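(* Let $m,n\ge 1$, let $A_1,\dots,A_m\in S^n$, and let $$r^*=\max\left\{\mathrm{rank}\Big(\sum_{i=1}^m t_iA_i\Big):\ \sum_{i=1}^m t_iA_i\succeq 0,\ t_i\in R,\ i=1,\dots,m\right\}.$$ Suppose that $r^*\le n-2$. Then the system $$\langle A_i,X\rangle=0,\quad i=1,\dots,m,\qquad X\succeq 0,\qquad X\in S^n,$$ has a rank-one solution if any of the following conditions holds: (i) For each $i$, $A_i$ is either positive semidefinite or negative semidefinite. (ii) There exists exactly one indefinite matrix among the $A_i$'s. (iii) There are more than one indefinite matrices among the $A_i$'s, and there is an indefinite matrix $A_k$ such that $$\{x\in R^n:\ x^TA_kx=0\}\ \subseteq\ \bigcap_{l\neq k,\ A_l\text{ indefinite}}\{x\in R^n:\ x^TA_lx=0\}.$$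
   Context: $S^n$ is the set of real symmetric $n\times n$ matrices; $\langle X,Y\rangle=\mathrm{tr}(X^TY)$; $X\succeq 0$ means positive semidefinite. A symmetric matrix is indefinite if it is neither positive semidefinite nor negative semidefinite. A rank-one solution is a solution $X$ with $\mathrm{rank}(X)=1$. *)

theory Defs
  imports "HOL-Analysis.Analysis"
begin

definition symmetric_matrix :: "real ^ 'n ^ 'n \<Rightarrow> bool" where
  "symmetric_matrix A \<longleftrightarrow> transpose A = A"

definition psd :: "real ^ 'n ^ 'n \<Rightarrow> bool" where
  "psd A \<longleftrightarrow> symmetric_matrix A \<and> (\<forall>x. 0 \<le> x \<bullet> (A *v x))"

definition nsd :: "real ^ 'n ^ 'n \<Rightarrow> bool" where
  "nsd A \<longleftrightarrow> symmetric_matrix A \<and> (\<forall>x. x \<bullet> (A *v x) \<le> 0)"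

definition indefinite :: "real ^ 'n ^ 'n \<Rightarrow> bool" where
  "indefinite A \<longleftrightarrow> symmetric_matrix A \<and> \<not> psd A \<and> \<not> nsd A"

definition matrix_inner :: "real ^ 'n ^ 'n \<Rightarrow> real ^ 'n ^ 'n \<Rightarrow> real" where
  "matrix_inner X Y = trace (transpose X ** Y)"

definition psd_span_ranks :: "nat \<Rightarrow> (nat \<Rightarrow> real ^ 'n ^ 'n) \<Rightarrow> nat set" where
  "psd_span_ranks m A =
     {rank (\<Sum>i=1..m. t i *\<^sub>R A i) | t. psd (\<Sum>i=1..m. t i *\<^sub>R A i)}"

text \<open>\<^const>\<open>Max\<close> is unspecified on empty and on infinite sets; neither occurs here.\<close>

lemma finite_psd_span_ranks:
  fixes A :: "nat \<Rightarrow> real ^ 'n ^ 'n"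
  shows "finite (psd_span_ranks m A)"
proof (rule finite_subset)
  show "psd_span_ranks m A \<subseteq> {..CARD('n)}"
  proof
    fix r assume "r \<in> psd_span_ranks m A"
    then obtain B :: "real ^ 'n ^ 'n" where "r = rank B"
      by (auto simp: psd_span_ranks_def)
    then show "r \<in> {..CARD('n)}"
      using rank_bound[of B] by simp
  qed
qed simp

lemma psd_span_ranks_nonempty: "psd_span_ranks m A \<noteq> {}"
proof -
  have "psd (0 :: real ^ 'n ^ 'n)"
    by (simp add: psd_def symmetric_matrix_def transpose_def vec_eq_iff)
  then have "\<exists>t. psd (\<Sum>i=1..m. t i *\<^sub>R A i)" for A :: "nat \<Rightarrow> real ^ 'n ^ 'n"
    by (intro exI[of _ "\<lambda>_. 0"]) simp
  then show ?thesis
    by (simp add: psd_span_ranks_def)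
qed

definition max_psd_rank :: "nat \<Rightarrow> (nat \<Rightarrow> real ^ 'n ^ 'n) \<Rightarrow> nat" where
  "max_psd_rank m A = Max (psd_span_ranks m A)"

definition indefinite_indices :: "nat \<Rightarrow> (nat \<Rightarrow> real ^ 'n ^ 'n) \<Rightarrow> nat set" where
  "indefinite_indices m A = {i \<in> {1..m}. indefinite (A i)}"

definition quadric :: "real ^ 'n ^ 'n \<Rightarrow> (real ^ 'n) set" where
  "quadric A = {x. x \<bullet> (A *v x) = 0}"

end

theory Submission
  imports Defs
begin

text \<open>
  It suffices to find a common nonzero isotropic vector x, since then X = x x^T solves the system.
  Let S be the sum of the semidefinite matrices, with signs making each of them positive
  semidefinite, and let B be the distinguished indefinite matrix (or 0 if there is none). If B has
  no nonzero isotropic vector in the kernel of S, then it is definite there by the intermediate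
  value theorem, so that by compactness B + c S or - B + c S is positive definite for large c. This
  contradicts the rank bound.
\<close>

section \<open>Symmetric matrices and their quadratic forms\<close>

lemma symmetric_matrix_dot:
  fixes A :: "real ^ 'n ^ 'n"
  assumes "symmetric_matrix A"
  shows "x \<bullet> (A *v y) = (A *v x) \<bullet> y"
  using assms by (metis dot_lmul_matrix symmetric_matrix_def transpose_matrix_vector)

lemma symmetric_matrix_add:
  "symmetric_matrix A \<Longrightarrow> symmetric_matrix B \<Longrightarrow> symmetric_matrix (A + B)"
  by (simp add: symmetric_matrix_def transpose_def vec_eq_iff)

lemma symmetric_matrix_scaleR: "symmetric_matrix A \<Longrightarrow> symmetric_matrix (c *\<^sub>R A)"
  by (simp add: symmetric_matrix_def transpose_def vec_eq_iff)

lemma symmetric_matrix_sum: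
  "(\<And>i. i \<in> I \<Longrightarrow> symmetric_matrix (F i)) \<Longrightarrow> symmetric_matrix (\<Sum>i\<in>I. F i)"
  by (simp add: symmetric_matrix_def transpose_def vec_eq_iff)

lemma scaleR_matrix_vector_mult: "(c *\<^sub>R A) *v x = c *\<^sub>R (A *v x)"
  for A :: "real ^ 'n ^ 'n"
  by (simp add: scaleR_matrix_vector_assoc)

lemma sum_matrix_vector_mult:
  fixes F :: "'i \<Rightarrow> real ^ 'n ^ 'n"
  shows "(\<Sum>i\<in>I. F i) *v x = (\<Sum>i\<in>I. F i *v x)"
  by (induction I rule: infinite_finite_induct) (simp_all add: matrix_vector_mult_add_rdistrib)

lemma quadratic_form_scaleR_vec: "(c *\<^sub>R x) \<bullet> (A *v (c *\<^sub>R x)) = c\<^sup>2 * (x \<bullet> (A *v x))"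
  for A :: "real ^ 'n ^ 'n"
  by (simp add: matrix_vector_mult_scaleR power2_eq_square)

lemma quadratic_form_combination:
  fixes A B :: "real ^ 'n ^ 'n"
  shows "x \<bullet> ((a *\<^sub>R A + b *\<^sub>R B) *v x) = a * (x \<bullet> (A *v x)) + b * (x \<bullet> (B *v x))"
  by (simp add: matrix_vector_mult_add_rdistrib scaleR_matrix_vector_mult inner_add_right)

lemma continuous_on_quadratic_form:
  fixes A :: "real ^ 'n ^ 'n"
  shows "continuous_on T (\<lambda>x. x \<bullet> (A *v x))"
  by (intro continuous_intros linear_continuous_on linear_linear[THEN iffD2] matrix_vector_mul_linear)

text \<open>The form of \<open>S\<close> is nonnegative on the line \<open>x + t y\<close> with
  \<open>y = S *v x\<close>, where it equals \<open>2 * t * a + t\<^sup>2 * c\<close>. If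
  \<open>a = y \<bullet> y\<close> were positive, a small negative \<open>t\<close> would make it
  negative.\<close>

lemma psd_isotropic_imp_kernel:
  fixes S :: "real ^ 'n ^ 'n"
  assumes "psd S" "x \<bullet> (S *v x) = 0"
  shows "S *v x = 0"
proof (rule ccontr)
  assume nz: "S *v x \<noteq> 0"
  define y where "y = S *v x"
  define a where "a = y \<bullet> y"
  define c where "c = y \<bullet> (S *v y)"
  have a: "a > 0" using nz by (simp add: a_def y_def)
  have c: "c \<ge> 0" using assms(1) by (simp add: c_def psd_def)
  have sym: "x \<bullet> (S *v y) = a"
    using assms(1) symmetric_matrix_dot[of S x y] by (simp add: psd_def a_def y_def)
  \<comment> \<open>The denominator is \<open>c + 1\<close> since \<open>c\<close> may vanish.
    Substituting \<open>a = - t * (c + 1)\<close> turns the value into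
    \<open>- (t\<^sup>2 * (c + 2))\<close>.\<close>
  define t where "t = - a / (c + 1)"
  have "0 \<le> (x + t *\<^sub>R y) \<bullet> (S *v (x + t *\<^sub>R y))"
    using assms(1) by (simp add: psd_def)
  also have "\<dots> = 2 * t * a + t\<^sup>2 * c"
    using assms(2) sym
    by (simp add: matrix_vector_right_distrib matrix_vector_mult_scaleR inner_add_left inner_add_right
        a_def c_def y_def[symmetric] power2_eq_square algebra_simps)
  also have "\<dots> = - (t\<^sup>2 * (c + 2))"
  proof -
    have "a = - t * (c + 1)" using c by (simp add: t_def)
    then show ?thesis by algebra
  qed
  also have "\<dots> < 0"
    using a c by (simp add: t_def)
  finally show False by simp
qed

text \<open>Opposite signs at \<open>x\<close> and \<open>y\<close> force a zero of the form on the
  segment between them. That zero can only be the origin, so \<open>y\<close> is a multiple of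
  \<open>x\<close>, and the two values differ by a square factor.\<close>

lemma no_isotropic_on_subspace_imp_same_sign:
  fixes B :: "real ^ 'n ^ 'n"
  assumes K: "subspace K" and nz: "\<And>x. x \<in> K \<Longrightarrow> x \<noteq> 0 \<Longrightarrow> x \<bullet> (B *v x) \<noteq> 0"
    and x: "x \<in> K" "x \<bullet> (B *v x) > 0" and y: "y \<in> K" "y \<noteq> 0"
  shows "y \<bullet> (B *v y) > 0"
proof (rule ccontr)
  assume "\<not> ?thesis"
  then have neg: "y \<bullet> (B *v y) < 0"
    using nz[OF y] by simp
  have "connected (closed_segment x y)" by simp
  then have "connected ((\<lambda>z. z \<bullet> (B *v z)) ` closed_segment x y)"
    by (rule connected_continuous_image[OF continuous_on_quadratic_form])
  then have "0 \<in> (\<lambda>z. z \<bullet> (B *v z)) ` closed_segment x y"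
    using neg x(2) by (meson connectedD_interval ends_in_segment image_eqI less_imp_le)
  then obtain z where z: "z \<in> closed_segment x y" "z \<bullet> (B *v z) = 0" by auto
  have "closed_segment x y \<subseteq> K"
    using x(1) y(1) K by (simp add: closed_segment_subset subspace_imp_convex)
  with z nz have "z = 0" by blast
  with z(1) obtain t where t: "0 \<le> t" "t \<le> 1" "0 = (1 - t) *\<^sub>R x + t *\<^sub>R y"
    by (auto simp: in_segment)
  \<comment> \<open>For \<open>t = 0\<close> the segment point would be \<open>x\<close>, which is
    nonzero because its form is positive.\<close>
  have "t \<noteq> 0" using t(3) x(2) by auto
  then have "y = ((t - 1) / t) *\<^sub>R x"
  proof -
    have "t *\<^sub>R y = (t - 1) *\<^sub>R x" using t(3) by (simp add: algebra_simps)
    then have "(1 / t) *\<^sub>R (t *\<^sub>R y) = (1 / t) *\<^sub>R ((t - 1) *\<^sub>R x)" by simp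
    then show ?thesis using \<open>t \<noteq> 0\<close> by simp
  qed
  then have "y \<bullet> (B *v y) = ((t - 1) / t)\<^sup>2 * (x \<bullet> (B *v x))"
    by (metis quadratic_form_scaleR_vec)
  with neg x(2) show False
    by (simp add: mult_less_0_iff)
qed

text \<open>Finsler's lemma.\<close>

lemma positive_on_isotropic_imp_positive_definite_sum:
  fixes S B :: "real ^ 'n ^ 'n"
  assumes S: "\<And>x. 0 \<le> x \<bullet> (S *v x)"
    and B: "\<And>x. x \<noteq> 0 \<Longrightarrow> x \<bullet> (S *v x) = 0 \<Longrightarrow> x \<bullet> (B *v x) > 0"
  shows "\<exists>c. \<forall>x. x \<noteq> 0 \<longrightarrow> x \<bullet> (B *v x) + c * (x \<bullet> (S *v x)) > 0"
proof -
  let ?q = "\<lambda>x. x \<bullet> (B *v x)" and ?s = "\<lambda>x. x \<bullet> (S *v x)"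
  \<comment> \<open>\<open>K\<close> is the compact set of unit vectors where \<open>B\<close> needs
    help from \<open>S\<close>. On it the form of \<open>S\<close> has no zero, hence a positive
    minimum.\<close>
  define K where "K = sphere 0 1 \<inter> {x. ?q x \<le> 0}"
  have "closed {x. ?q x \<le> 0}"
    by (intro closed_Collect_le continuous_on_quadratic_form continuous_on_const)
  then have "compact K"
    unfolding K_def by (intro compact_Int_closed) auto
  have "\<exists>c. \<forall>x \<in> sphere 0 1. ?q x + c * ?s x > 0"
  proof (cases "K = {}")
    case True
    then show ?thesis by (intro exI[of _ 0]) (force simp: K_def not_le[symmetric])
  next
    case False
    obtain u where u: "u \<in> K" "\<And>x. x \<in> K \<Longrightarrow> ?s u \<le> ?s x"
      using continuous_attains_inf[OF \<open>compact K\<close> False continuous_on_quadratic_form] by blast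
    obtain v where v: "v \<in> K" "\<And>x. x \<in> K \<Longrightarrow> ?q v \<le> ?q x"
      using continuous_attains_inf[OF \<open>compact K\<close> False continuous_on_quadratic_form] by blast
    have "u \<noteq> 0" "?q u \<le> 0" using u(1) by (auto simp: K_def)
    then have su: "?s u > 0" using S[of u] B[of u] by fastforce
    have qv: "?q v \<le> 0" using v(1) by (simp add: K_def)
    \<comment> \<open>With the minima \<open>?s u\<close> and \<open>?q v\<close> over
      \<open>K\<close>, this \<open>c\<close> makes the sum at least 1 on \<open>K\<close>.\<close>
    define c where "c = (1 - ?q v) / ?s u"
    have c: "c > 0" using su qv by (simp add: c_def)
    have "?q x + c * ?s x > 0" if x: "x \<in> sphere 0 1" for x
    proof (cases "x \<in> K")
      case True
      have "1 - ?q v = c * ?s u" using su by (simp add: c_def)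
      also have "\<dots> \<le> c * ?s x" using u(2)[OF True] c by simp
      finally show ?thesis using v(2)[OF True] by linarith
    next
      case False
      then have "?q x > 0" using x by (simp add: K_def)
      moreover have "c * ?s x \<ge> 0" using c S[of x] by simp
      ultimately show ?thesis by linarith
    qed
    then show ?thesis by blast
  qed
  then obtain c where c: "\<And>x. x \<in> sphere 0 1 \<Longrightarrow> ?q x + c * ?s x > 0" by blast
  \<comment> \<open>Both forms are homogeneous of degree two, so positivity passes from the sphere
    to all nonzero vectors.\<close>
  have "?q x + c * ?s x > 0" if "x \<noteq> 0" for x
  proof -
    define y where "y = (1 / norm x) *\<^sub>R x"
    have x: "x = norm x *\<^sub>R y" using that by (simp add: y_def)
    have "y \<in> sphere 0 1" using that by (simp add: y_def)
    then have "(norm x)\<^sup>2 * (?q y + c * ?s y) > 0" using c that by simp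
    also have "(norm x)\<^sup>2 * (?q y + c * ?s y) = ?q x + c * ?s x"
      using quadratic_form_scaleR_vec[of "norm x" y B] quadratic_form_scaleR_vec[of "norm x" y S]
      by (simp add: x[symmetric] algebra_simps)
    finally show ?thesis .
  qed
  then show ?thesis by blast
qed

lemma positive_definite_full_rank:
  fixes M :: "real ^ 'n ^ 'n"
  assumes "\<And>x. x \<noteq> 0 \<Longrightarrow> x \<bullet> (M *v x) > 0"
  shows "rank M = CARD('n)"
  unfolding full_rank_injective
proof (rule injI)
  fix x y assume "M *v x = M *v y"
  then have "M *v (x - y) = 0" by (simp add: matrix_vector_mult_diff_distrib)
  then show "x = y" using assms[of "x - y"] by fastforce
qed

text \<open>The assumption \<open>rank\<close> excludes positive definite matrices from the span of
  \<open>S\<close> and \<open>B\<close>. It is used twice: to make \<open>S\<close> singular, and to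
  refute the positive definite combination supplied by Finsler's lemma.\<close>

lemma common_isotropic_vector:
  fixes S B :: "real ^ 'n ^ 'n"
  assumes S: "psd S" and B: "symmetric_matrix B"
    and rank: "\<And>a b. psd (a *\<^sub>R S + b *\<^sub>R B) \<Longrightarrow> rank (a *\<^sub>R S + b *\<^sub>R B) < CARD('n)"
  shows "\<exists>x. x \<noteq> 0 \<and> x \<bullet> (S *v x) = 0 \<and> x \<bullet> (B *v x) = 0"
proof (rule ccontr)
  assume "\<not> ?thesis"
  then have none: "x \<bullet> (B *v x) \<noteq> 0" if "x \<noteq> 0" "x \<bullet> (S *v x) = 0" for x
    using that by blast
  define K where "K = {x. S *v x = 0}"
  have K: "subspace K"
    by (auto simp: K_def subspace_def matrix_vector_right_distrib matrix_vector_mult_scaleR)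
  have "\<not> inj ((*v) S)"
    using rank[of 1 0] S by (simp flip: full_rank_injective)
  then obtain u v where "S *v u = S *v v" "u \<noteq> v" by (auto simp: inj_def)
  then have z: "u - v \<in> K" "u - v \<noteq> 0"
    by (simp_all add: K_def matrix_vector_mult_diff_distrib)
  define z where "z = u - v"
  have "z \<bullet> (B *v z) \<noteq> 0" using none z by (simp add: K_def z_def)
  \<comment> \<open>The factor \<open>e\<close> carries the sign of \<open>B\<close> at the kernel
    vector \<open>z\<close>, so that both signs are treated at once.\<close>
  then obtain e :: real where e: "e * (z \<bullet> (B *v z)) > 0"
    by (metis not_real_square_gt_zero)
  let ?B = "e *\<^sub>R B"
  have eB: "x \<bullet> (?B *v x) = e * (x \<bullet> (B *v x))" for x
    by (simp add: scaleR_matrix_vector_mult)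
  have "x \<bullet> (?B *v x) > 0" if "x \<noteq> 0" "x \<bullet> (S *v x) = 0" for x
  proof (rule no_isotropic_on_subspace_imp_same_sign[OF K])
    show "y \<bullet> (?B *v y) \<noteq> 0" if "y \<in> K" "y \<noteq> 0" for y
      using none[of y] that e by (auto simp: K_def eB)
    show "z \<in> K" "z \<bullet> (?B *v z) > 0" using z e unfolding eB z_def by auto
    \<comment> \<open>Positive semidefiniteness identifies the isotropic vectors of \<open>S\<close>
      with its kernel, a subspace.\<close>
    show "x \<in> K" using psd_isotropic_imp_kernel[OF S that(2)] by (simp add: K_def)
  qed fact
  then obtain c where c: "\<And>x. x \<noteq> 0 \<Longrightarrow> x \<bullet> (?B *v x) + c * (x \<bullet> (S *v x)) > 0"
    using positive_on_isotropic_imp_positive_definite_sum[of S ?B] S unfolding psd_def by blast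
  let ?M = "c *\<^sub>R S + e *\<^sub>R B"
  have pos: "x \<bullet> (?M *v x) > 0" if "x \<noteq> 0" for x
    using c[OF that] by (simp add: quadratic_form_combination eB add.commute)
  have "0 \<le> x \<bullet> (?M *v x)" for x
    using pos[of x] by (cases "x = 0") auto
  moreover have "symmetric_matrix ?M"
    using S B by (auto simp: psd_def intro: symmetric_matrix_add symmetric_matrix_scaleR)
  ultimately have "psd ?M" by (simp add: psd_def)
  then show False
    using rank positive_definite_full_rank[of ?M] pos by (metis less_irrefl)
qed

section \<open>Rank-one matrices\<close>

text \<open>The matrix x x^T, given by entries so that no column matrices are required.\<close>

definition outer_square :: "real ^ 'n \<Rightarrow> real ^ 'n ^ 'n" where
  "outer_square x = (\<chi> i j. x $ i * x $ j)"

lemma outer_square_mult_vec: "outer_square x *v y = (x \<bullet> y) *\<^sub>R x"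
  by (simp add: outer_square_def matrix_vector_mult_def vec_eq_iff inner_vec_def
      sum_distrib_left mult_ac)

lemma psd_outer_square: "psd (outer_square x)"
  unfolding psd_def
proof (intro conjI allI)
  show "symmetric_matrix (outer_square x)"
    by (simp add: symmetric_matrix_def outer_square_def transpose_def mult.commute)
  show "0 \<le> y \<bullet> (outer_square x *v y)" for y
    by (simp add: outer_square_mult_vec inner_commute)
qed

lemma rank_outer_square:
  assumes "x \<noteq> 0"
  shows "rank (outer_square x) = 1"
proof -
  have "range ((*v) (outer_square x)) = span {x}"
  proof (intro equalityI subsetI)
    fix v assume "v \<in> span {x}"
    then obtain k where k: "v = k *\<^sub>R x" by (auto simp: span_singleton)
    have "v = outer_square x *v ((k / (x \<bullet> x)) *\<^sub>R x)"
      using assms by (simp add: outer_square_mult_vec k)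
    then show "v \<in> range ((*v) (outer_square x))" by blast
  qed (auto simp: outer_square_mult_vec span_singleton)
  then show ?thesis
    using assms by (simp add: rank_dim_range dim_eq_card_independent)
qed

text \<open>Both sides are the same double sum; the trace runs over the columns of \<open>A\<close>
  first, whence the swap. Linear equations in X thus become isotropy conditions on
  \<open>x\<close>.\<close>

lemma matrix_inner_outer_square: "matrix_inner A (outer_square x) = x \<bullet> (A *v x)"
proof -
  have "matrix_inner A (outer_square x) = (\<Sum>i\<in>UNIV. \<Sum>j\<in>UNIV. A $ j $ i * (x $ j * x $ i))"
    by (simp add: matrix_inner_def trace_def transpose_def matrix_matrix_mult_def outer_square_def)
  also have "\<dots> = (\<Sum>j\<in>UNIV. \<Sum>i\<in>UNIV. A $ j $ i * (x $ j * x $ i))"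
    by (rule sum.swap)
  also have "\<dots> = x \<bullet> (A *v x)"
    by (simp add: inner_vec_def matrix_vector_mult_def sum_distrib_left mult_ac)
  finally show ?thesis .
qed

section \<open>Reduction of the matrix family to two matrices\<close>

lemma rank_le_max_psd_rank:
  assumes "psd (\<Sum>i=1..m. t i *\<^sub>R A i)"
  shows "rank (\<Sum>i=1..m. t i *\<^sub>R A i) \<le> max_psd_rank m A"
  unfolding max_psd_rank_def
  using assms finite_psd_span_ranks by (intro Max_ge) (auto simp: psd_span_ranks_def)

text \<open>Every combination of \<open>S\<close> and \<open>B\<close> is again one of the
  \<open>A i\<close>, so the bound on \<open>max_psd_rank\<close> yields the rank assumption of
  \<open>common_isotropic_vector\<close>.\<close>

lemma semidefinite_and_combination_isotropic:
  fixes A :: "nat \<Rightarrow> real ^ 'n ^ 'n"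
  assumes sym: "\<And>i. i \<in> {1..m} \<Longrightarrow> symmetric_matrix (A i)"
    and rank: "max_psd_rank m A < CARD('n)"
    and B: "B = (\<Sum>i=1..m. u i *\<^sub>R A i)"
  shows "\<exists>x. x \<noteq> 0 \<and> x \<bullet> (B *v x) = 0
    \<and> (\<forall>i\<in>{1..m}. psd (A i) \<or> nsd (A i) \<longrightarrow> x \<bullet> (A i *v x) = 0)"
proof -
  \<comment> \<open>The signs make every term of \<open>S\<close> nonnegative, so an isotropic
    vector of \<open>S\<close> annihilates each term; the weight 0 leaves indefinite matrices
    out.\<close>
  define s :: "nat \<Rightarrow> real" where "s i = (if psd (A i) then 1 else if nsd (A i) then - 1 else 0)" for i
  define S where "S = (\<Sum>i=1..m. s i *\<^sub>R A i)"
  have s: "0 \<le> s i * (x \<bullet> (A i *v x))" for i x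
    by (auto simp: s_def psd_def nsd_def)
  have Sx: "x \<bullet> (S *v x) = (\<Sum>i=1..m. s i * (x \<bullet> (A i *v x)))" for x
    by (simp add: S_def sum_matrix_vector_mult scaleR_matrix_vector_mult inner_sum_right)
  have "psd S"
    unfolding psd_def Sx
    by (auto simp: S_def s intro!: sum_nonneg symmetric_matrix_sum symmetric_matrix_scaleR sym)
  moreover have "symmetric_matrix B"
    unfolding B by (intro symmetric_matrix_sum symmetric_matrix_scaleR sym)
  moreover have "rank (a *\<^sub>R S + b *\<^sub>R B) < CARD('n)" if "psd (a *\<^sub>R S + b *\<^sub>R B)" for a b
  proof -
    have "a *\<^sub>R S + b *\<^sub>R B = (\<Sum>i=1..m. (a * s i + b * u i) *\<^sub>R A i)"
      by (simp add: S_def B scaleR_sum_right scaleR_add_left sum.distrib)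
    then show ?thesis
      using that rank rank_le_max_psd_rank[where t = "\<lambda>i. a * s i + b * u i" and m = m and A = A]
      by simp
  qed
  ultimately obtain x where x: "x \<noteq> 0" "x \<bullet> (S *v x) = 0" "x \<bullet> (B *v x) = 0"
    using common_isotropic_vector by blast
  have "x \<bullet> (A i *v x) = 0" if "i \<in> {1..m}" "psd (A i) \<or> nsd (A i)" for i
  proof -
    have "s i * (x \<bullet> (A i *v x)) = 0"
      using x(2) s that(1) unfolding Sx by (simp add: sum_nonneg_eq_0_iff)
    moreover have "s i \<noteq> 0" using that(2) by (auto simp: s_def)
    ultimately show ?thesis by simp
  qed
  with x show ?thesis by blast
qed

theorem theorem3p4:
  fixes A :: "nat \<Rightarrow> real ^ 'n ^ 'n" and m :: nat
  assumes "m \<ge> 1"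
    and "\<forall>i\<in>{1..m}. symmetric_matrix (A i)"
    and "int (max_psd_rank m A) \<le> int CARD('n) - 2"
    and "(\<forall>i\<in>{1..m}. psd (A i) \<or> nsd (A i))
       \<or> card (indefinite_indices m A) = 1
       \<or> (card (indefinite_indices m A) > 1
          \<and> (\<exists>k\<in>indefinite_indices m A.
               quadric (A k) \<subseteq> (\<Inter>l\<in>indefinite_indices m A - {k}. quadric (A l))))"
  shows "\<exists>X :: real ^ 'n ^ 'n. symmetric_matrix X \<and> psd X
           \<and> (\<forall>i\<in>{1..m}. matrix_inner (A i) X = 0) \<and> rank X = 1"
proof -
  have indef: "psd (A i) \<or> nsd (A i) \<or> i \<in> indefinite_indices m A" if "i \<in> {1..m}" for i
    using assms(2) that by (auto simp: indefinite_indices_def indefinite_def)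
  \<comment> \<open>One combination is to control all indefinite matrices: any \<open>u\<close> if
    there are none, otherwise the indicator of the distinguished index \<open>k\<close>.\<close>
  have "\<exists>u. \<forall>x. x \<bullet> ((\<Sum>i=1..m. u i *\<^sub>R A i) *v x) = 0 \<longrightarrow>
      (\<forall>i\<in>indefinite_indices m A. x \<bullet> (A i *v x) = 0)"
  proof (cases "indefinite_indices m A = {}")
    case False
    then have "\<not> (\<forall>i\<in>{1..m}. psd (A i) \<or> nsd (A i))"
      by (auto simp: indefinite_indices_def indefinite_def)
    \<comment> \<open>A single indefinite matrix is covered too: the intersection over the empty
      index set is the whole space.\<close>
    with assms(4) have "\<exists>k\<in>indefinite_indices m A.
        quadric (A k) \<subseteq> (\<Inter>l\<in>indefinite_indices m A - {k}. quadric (A l))"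
      by (auto simp: card_1_singleton_iff)
    then obtain k where k: "k \<in> indefinite_indices m A"
      and sub: "quadric (A k) \<subseteq> (\<Inter>l\<in>indefinite_indices m A - {k}. quadric (A l))"
      by blast
    have "(\<Sum>i=1..m. of_bool (i = k) *\<^sub>R A i) = A k"
      using k
      by (simp add: indefinite_indices_def of_bool_def if_distrib[where f = "\<lambda>c. c *\<^sub>R A _"] cong: if_cong)
    moreover have "x \<bullet> (A l *v x) = 0"
      if "x \<bullet> (A k *v x) = 0" "l \<in> indefinite_indices m A" for x l
      using sub that by (cases "l = k") (auto simp: quadric_def)
    ultimately show ?thesis
      by (intro exI[of _ "\<lambda>i. of_bool (i = k)"]) simp
  qed simp
  then obtain u where u: "\<And>x i. x \<bullet> ((\<Sum>i=1..m. u i *\<^sub>R A i) *v x) = 0 \<Longrightarrow>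
      i \<in> indefinite_indices m A \<Longrightarrow> x \<bullet> (A i *v x) = 0" by blast
  have "max_psd_rank m A < CARD('n)" using assms(3) by linarith
  then obtain x where x: "x \<noteq> 0" "x \<bullet> ((\<Sum>i=1..m. u i *\<^sub>R A i) *v x) = 0"
      "\<And>i. i \<in> {1..m} \<Longrightarrow> psd (A i) \<or> nsd (A i) \<Longrightarrow> x \<bullet> (A i *v x) = 0"
    using semidefinite_and_combination_isotropic[of m A _ u] assms(2) by blast
  \<comment> \<open>By \<open>indef\<close>, each index falls under \<open>x(3)\<close>
    (semidefinite) or \<open>u\<close> (indefinite).\<close>
  have "\<forall>i\<in>{1..m}. matrix_inner (A i) (outer_square x) = 0"
    unfolding matrix_inner_outer_square using indef u[OF x(2)] x(3) by blast
  with x(1) show ?thesis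
    using psd_outer_square[of x] rank_outer_square[of x] by (auto simp: psd_def)
qed

end
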